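(* Let $\alpha,\beta\in\mathbb{C}\setminus\mathbb{Z}^-$ with $\operatorname{Re}(\alpha+\beta)>-1$, let $1\le p\le\infty$ with conjugate exponent $q$ ($\frac1p+\frac1q=1$), let $f\in L^p(\mathbb{T})$ and let $w=K_{\alpha,\beta}[f]$, an $(\alpha,\beta)$-harmonic function on $\mathbb{D}$. Then for all $z=re^{i\theta}\in\mathbb{D}$, the quantity $$\frac{|w_z(z)|}{|\alpha+1|+|\beta||z|}+\frac{|w_{\bar z}(z)|}{|\beta+1|+|\alpha||z|}$$ is at most $$2|c_{\alpha,\beta}|\exp\left(\frac\pi2|\operatorname{Im}(\alpha-\beta)|\right)\frac{(1-|z|^2)^{\operatorname{Re}(\alpha+\beta)}}{(1-|z|)^{\operatorname{Re}(\alpha+\beta)+2}}\|f\|_{L^1(\mathbb{T})}\qquad\text{if }p=1,$$ and at most $$\frac{2|c_{\alpha,\beta}|\,\|f\|_{L^p(\mathbb{T})}}{(1-|z|^2)^{1+1/p}}\exp\left(\frac\pi2|\operatorname{Im}(\alpha-\beta)|\right)F_2\qquad\text{if }1<p\le\infty,$$ where $$F_2=\left(F\left(1-\frac{(\operatorname{Re}(\alpha+\beta)+2)q}{2},1-\frac{(\operatorname{Re}(\alpha+\beta)+2)q}{2};1;r^2\right)\right)^{1/q}.$$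
   Context: $\mathbb{D}=\{z\in\mathbb{C}:|z|<1\}$, $\mathbb{T}=\{z\in\mathbb{C}:|z|=1\}$, and $\mathbb{Z}^-$ is the set of negative integers. Set $c_{\alpha,\beta}=\dfrac{\Gamma(\alpha+1)\Gamma(\beta+1)}{\Gamma(\alpha+\beta+1)}$ and $$K_{\alpha,\beta}(z)=c_{\alpha,\beta}\frac{(1-|z|^2)^{\alpha+\beta+1}}{(1-z)^{\alpha+1}(1-\bar z)^{\beta+1}}\quad(z\in\mathbb{D}),$$ with principal branches of the powers, and $$K_{\alpha,\beta}[f](z)=\frac1{2\pi}\int_0^{2\pi}K_{\alpha,\beta}(ze^{-it})f(e^{it})\,dt ;$$ this is an $(\alpha,\beta)$-harmonic function, i.e. a $C^2$ solution in $\mathbb{D}$ of $(1-|z|^2)\partial_z\partial_{\bar z}w+\alpha z\partial_zw+\beta\bar z\partial_{\bar z}w-\alpha\beta w=0$. Here $w_z=\frac12(w_x-iw_y)$ and $w_{\bar z}=\frac12(w_x+iw_y)$. $\|f\|_{L^p(\mathbb{T})}=\left(\frac1{2\pi}\int_0^{2\pi}|f(e^{i\theta})|^p\,d\theta\right)^{1/p}$ for $p<\infty$, and the essential supremum of $|f|$ for $p=\infty$; for $p=\infty$ one reads $1/p=0$, $q=1$. $F(a,b;c;x)=\sum_{n\ge0}\frac{(a)_n(b)_n}{(c)_n}\frac{x^n}{n!}$ is the Gauss hypergeometric function, with $(a)_0=1$, $(a)_n=a(a+1)\cdots(a+n-1)$. *)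

theory Defs
  imports "HOL-Analysis.Analysis" "HOL-Probability.Essential_Supremum"
begin

text \<open>Functions on the unit circle are represented by functions on \<^typ>\<open>complex\<close> of which only
  the values \<open>f (cis t)\<close>, for \<open>t \<in> {0..2 * pi}\<close>, are used.\<close>

abbreviation arc :: "real measure" where
  "arc \<equiv> lebesgue_on {0..2 * pi}"

text \<open>The exponent \<open>p\<close> ranges over the extended nonnegative reals; only \<open>p \<ge> 1\<close> is meaningful.\<close>

definition circle_Lp :: "ennreal \<Rightarrow> (complex \<Rightarrow> complex) set" where
  "circle_Lp p = {f. (\<lambda>t. f (cis t)) \<in> borel_measurable arc \<and>
     (if p = \<infinity> then esssup arc (\<lambda>t. ennreal (norm (f (cis t)))) < \<infinity>
      else integrable arc (\<lambda>t. norm (f (cis t)) powr enn2real p))}"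

definition circle_norm :: "ennreal \<Rightarrow> (complex \<Rightarrow> complex) \<Rightarrow> real" where
  "circle_norm p f =
     (if p = \<infinity> then enn2real (esssup arc (\<lambda>t. ennreal (norm (f (cis t)))))
      else (1 / (2 * pi) * (LINT t|arc. norm (f (cis t)) powr enn2real p)) powr (1 / enn2real p))"

definition c_coeff :: "complex \<Rightarrow> complex \<Rightarrow> complex" where
  "c_coeff \<alpha> \<beta> = Gamma (\<alpha> + 1) * Gamma (\<beta> + 1) / Gamma (\<alpha> + \<beta> + 1)"

text \<open>Complex \<^const>\<open>powr\<close> is the principal branch.\<close>

definition K_kernel :: "complex \<Rightarrow> complex \<Rightarrow> complex \<Rightarrow> complex" where
  "K_kernel \<alpha> \<beta> z = c_coeff \<alpha> \<beta> *
     (of_real (1 - (norm z)\<^sup>2) powr (\<alpha> + \<beta> + 1) /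
      ((1 - z) powr (\<alpha> + 1) * (1 - cnj z) powr (\<beta> + 1)))"

definition K_integral :: "complex \<Rightarrow> complex \<Rightarrow> (complex \<Rightarrow> complex) \<Rightarrow> complex \<Rightarrow> complex" where
  "K_integral \<alpha> \<beta> f z =
     1 / (2 * of_real pi) * (LINT t|arc. K_kernel \<alpha> \<beta> (z * cis (- t)) * f (cis t))"

definition partial_x :: "(complex \<Rightarrow> complex) \<Rightarrow> complex \<Rightarrow> complex" where
  "partial_x w z = vector_derivative (\<lambda>t. w (z + of_real t)) (at 0)"

definition partial_y :: "(complex \<Rightarrow> complex) \<Rightarrow> complex \<Rightarrow> complex" where
  "partial_y w z = vector_derivative (\<lambda>t. w (z + \<i> * of_real t)) (at 0)"

definition wirtinger_z :: "(complex \<Rightarrow> complex) \<Rightarrow> complex \<Rightarrow> complex" where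
  "wirtinger_z w z = 1 / 2 * (partial_x w z - \<i> * partial_y w z)"

definition wirtinger_cnj :: "(complex \<Rightarrow> complex) \<Rightarrow> complex \<Rightarrow> complex" where
  "wirtinger_cnj w z = 1 / 2 * (partial_x w z + \<i> * partial_y w z)"

definition gauss_F :: "real \<Rightarrow> real \<Rightarrow> real \<Rightarrow> real \<Rightarrow> real" where
  "gauss_F a b c x =
     (\<Sum>n. pochhammer a n * pochhammer b n / pochhammer c n * (x ^ n / fact n))"

end

theory Submission
  imports Defs
begin

text \<open>
  The kernel satisfies
  \<open>\<partial>\<^sub>u K = K ((\<alpha> + 1) (1 - cnj u) - \<beta> cnj u (1 - u)) / ((1 - \<bar>u\<bar>\<^sup>2) (1 - u))\<close>, and the numerator
  is at most \<open>(\<bar>\<alpha> + 1\<bar> + \<bar>\<beta>\<bar> \<bar>u\<bar>) \<bar>1 - u\<bar>\<close>; the same holds for \<open>\<partial>\<close> with respect to \<open>cnj u\<close>.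
  As \<open>\<bar>Arg (1 - u)\<bar> \<le> \<pi> / 2\<close>, differentiating under the integral bounds both quotients by
  \<open>\<bar>c\<bar> exp (\<pi> / 2 \<bar>Im (\<alpha> - \<beta>)\<bar>) (1 - r\<^sup>2) powr (s - 2)\<close> times the mean of
  \<open>\<bar>1 - z cis (- t)\<bar> powr (- s) \<bar>f (cis t)\<bar>\<close>, where \<open>s = Re (\<alpha> + \<beta>) + 2\<close>. Hoelder's inequality
  reduces the claim to the mean of \<open>\<bar>1 - v cis t\<bar> powr (- s q)\<close> with \<open>v = cnj z\<close>. A Moebius change
  of the angle turns this into a multiple of the mean of \<open>\<bar>1 + v cis t\<bar> powr (s q - 2)\<close>, which
  Parseval's identity for the binomial series evaluates as a hypergeometric function; this
  replaces Euler's transformation.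
\<close>

subsection \<open>Means of powers over the circle\<close>

lemma integrable_continuous_lebesgue_on:
  fixes f :: "real \<Rightarrow> 'a::euclidean_space"
  assumes "continuous_on {a..b} f"
  shows "integrable (lebesgue_on {a..b}) f"
  using absolutely_integrable_continuous_real[OF assms]
  by (simp add: set_integrable_def integrable_restrict_space)

lemma LINT_continuous_lebesgue_on:
  fixes f :: "real \<Rightarrow> 'a::euclidean_space"
  assumes "continuous_on {a..b} f"
  shows "(LINT t|lebesgue_on {a..b}. f t) = integral {a..b} f"
  by (simp add: assms integrable_continuous_lebesgue_on lebesgue_integral_eq_integral)

text \<open>The base point \<open>a\<close> stays free because the later change of angle carries
  \<open>{0..2 * pi}\<close> to a period that starts elsewhere.\<close>

lemma LINT_cis:
  "(LINT t|lebesgue_on {a..a + 2 * pi}. cis (of_int k * t)) = (if k = 0 then 2 * pi else 0)"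
proof (cases "k = 0")
  case True
  then show ?thesis
    by (simp add: measure_restrict_space scaleR_conv_of_real)
next
  case False
  define F where "F t = cis (of_int k * t) / (\<i> * of_int k)" for t
  have "((\<lambda>z. exp (\<i> * of_int k * z) / (\<i> * of_int k)) has_field_derivative
         exp (\<i> * of_int k * z)) (at z)" for z
    using False by (auto intro!: derivative_eq_intros)
  from has_vector_derivative_real_field[OF this]
  have "((\<lambda>t. exp (\<i> * of_int k * of_real t)) has_integral (F (a + 2 * pi) - F a)) {a..a + 2 * pi}"
    unfolding F_def cis_conv_exp
    by (intro fundamental_theorem_of_calculus) (auto simp: mult_ac)
  then have "((\<lambda>t. cis (of_int k * t)) has_integral (F (a + 2 * pi) - F a)) {a..a + 2 * pi}"
    by (simp add: cis_conv_exp mult_ac)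
  moreover have "F (a + 2 * pi) = F a"
  proof -
    have "of_int k * (a + 2 * pi) = of_int k * a + 2 * pi * of_int k"
      by (simp add: algebra_simps)
    then show ?thesis
      unfolding F_def by (simp add: cis_mult[symmetric] cis_multiple_2pi)
  qed
  ultimately have "integral {a..a + 2 * pi} (\<lambda>t. cis (of_int k * t)) = 0"
    by (simp add: integral_unique)
  with False show ?thesis
    by (subst LINT_continuous_lebesgue_on) (auto intro!: continuous_intros)
qed

text \<open>Parseval's identity. Absolute summability of the coefficients justifies both exchanges
  of sum and integral, so no Hilbert space theory enters.\<close>

lemma sums_square_norm_Fourier_coeffs:
  fixes d :: "nat \<Rightarrow> complex"
  assumes d: "summable (\<lambda>n. norm (d n))"
  shows "(\<lambda>n. (norm (d n))\<^sup>2) sums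
    (1 / (2 * pi) * (LINT t|lebesgue_on {a..a + 2 * pi}. (norm (\<Sum>n. d n * cis (real n * t)))\<^sup>2))"
proof -
  define M where "M = lebesgue_on {a..a + 2 * pi}"
  define S where "S t = (\<Sum>n. d n * cis (real n * t))" for t
  have cis_M [measurable]: "(\<lambda>t. cis (c * t)) \<in> borel_measurable M" for c
    unfolding M_def by (intro borel_measurable_integrable integrable_continuous_lebesgue_on continuous_intros)
  have S_M [measurable]: "S \<in> borel_measurable M"
    unfolding S_def by measurable
  interpret finite_measure M
    unfolding M_def by (rule finite_measure_lebesgue_on) auto
  have meas: "measure M (space M) = 2 * pi"
    by (simp add: M_def measure_restrict_space)
  have S_le: "norm (S t) \<le> (\<Sum>n. norm (d n))" for t
    unfolding S_def using summable_norm[of "\<lambda>n. d n * cis (real n * t)"] d by (simp add: norm_mult)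
  have coeff: "(LINT t|M. cis (- real m * t) * S t) = 2 * pi * d m" for m
  proof -
    have eq: "cis (- real m * t) * S t = (\<Sum>n. d n * cis (of_int (int n - int m) * t))" for t
    proof -
      have "summable (\<lambda>n. d n * cis (real n * t))"
        by (rule summable_norm_cancel) (use d in \<open>simp add: norm_mult\<close>)
      then have "cis (- real m * t) * S t = (\<Sum>n. cis (- real m * t) * (d n * cis (real n * t)))"
        unfolding S_def by (rule suminf_mult[symmetric])
      also have "\<dots> = (\<Sum>n. d n * cis (of_int (int n - int m) * t))"
        by (intro suminf_cong) (simp add: cis_mult algebra_simps)
      finally show ?thesis .
    qed
    have "(\<lambda>n. LINT t|M. d n * cis (of_int (int n - int m) * t)) sums
          (LINT t|M. (\<Sum>n. d n * cis (of_int (int n - int m) * t)))"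
    proof (rule sums_integral)
      show "integrable M (\<lambda>t. d n * cis (of_int (int n - int m) * t))" for n
        unfolding M_def by (intro integrable_continuous_lebesgue_on continuous_intros)
      show "AE t in M. summable (\<lambda>n. norm (d n * cis (of_int (int n - int m) * t)))"
        using d by (simp add: norm_mult)
      show "summable (\<lambda>n. LINT t|M. norm (d n * cis (of_int (int n - int m) * t)))"
        using summable_mult[OF d, of "2 * pi"] by (simp add: norm_mult meas)
    qed
    moreover have "(LINT t|M. d n * cis (of_int (int n - int m) * t)) = (if n = m then 2 * pi * d n else 0)" for n
      using LINT_cis[of a "int n - int m"] by (simp add: M_def)
    ultimately have "(\<lambda>n. if n = m then 2 * pi * d n else 0) sums (LINT t|M. cis (- real m * t) * S t)"
      by (simp only: eq)
    moreover have "(\<lambda>n. if n = m then 2 * pi * d n else 0) sums (2 * pi * d m)"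
      by (rule sums_single)
    ultimately show ?thesis
      by (rule sums_unique2)
  qed
  \<comment> \<open>Only the conjugated factor of \<open>cnj (S t) * S t\<close> is expanded. The
    remaining integrals are then the Fourier coefficients in \<open>coeff\<close>, and no double
    series arises.\<close>
  have sq: "complex_of_real ((norm (S t))\<^sup>2) = (\<Sum>n. cnj (d n) * (cis (- real n * t) * S t))" for t
  proof -
    have "(\<lambda>n. d n * cis (real n * t)) sums S t"
      unfolding S_def
      by (rule summable_sums, rule summable_norm_cancel) (use d in \<open>simp add: norm_mult\<close>)
    then have "(\<lambda>n. cnj (d n * cis (real n * t)) * S t) sums (cnj (S t) * S t)"
      by (intro sums_mult2) (simp only: sums_cnj)
    then show ?thesis
      by (simp add: cis_cnj sums_iff mult.assoc complex_norm_square mult.commute[of "S t"] del: of_real_power)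
  qed
  have "(\<lambda>n. LINT t|M. cnj (d n) * (cis (- real n * t) * S t)) sums
        (LINT t|M. (\<Sum>n. cnj (d n) * (cis (- real n * t) * S t)))"
  proof (rule sums_integral)
    show int: "integrable M (\<lambda>t. cnj (d n) * (cis (- real n * t) * S t))" for n
    proof (rule integrable_const_bound)
      show "AE t in M. norm (cnj (d n) * (cis (- real n * t) * S t)) \<le> norm (d n) * (\<Sum>n. norm (d n))"
        by (auto simp: norm_mult intro!: mult_left_mono S_le)
      show "(\<lambda>t. cnj (d n) * (cis (- real n * t) * S t)) \<in> borel_measurable M"
        by measurable
    qed
    show "AE t in M. summable (\<lambda>n. norm (cnj (d n) * (cis (- real n * t) * S t)))"
      using d by (auto simp: norm_mult intro!: summable_mult2)
    show "summable (\<lambda>n. LINT t|M. norm (cnj (d n) * (cis (- real n * t) * S t)))"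
      using summable_mult2[OF d, of "LINT t|M. norm (S t)"] by (simp add: norm_mult)
  qed
  then have "(\<lambda>n. complex_of_real (2 * pi * (norm (d n))\<^sup>2)) sums (LINT t|M. complex_of_real ((norm (S t))\<^sup>2))"
    by (simp only: sq[symmetric] integral_mult_right_zero coeff)
       (simp add: complex_norm_square mult_ac del: of_real_power)
  then have "(\<lambda>n. 2 * pi * (norm (d n))\<^sup>2) sums (LINT t|M. (norm (S t))\<^sup>2)"
    by (simp only: integral_complex_of_real sums_of_real_iff)
  from sums_mult[OF this, of "1 / (2 * pi)"] show ?thesis
    by (simp add: M_def S_def)
qed

section \<open>The binomial series on a circle\<close>

lemma norm_powr_of_real:
  "norm (z powr of_real b) = norm z powr b" for z :: complex
  by (simp add: powr_def)

text \<open>The numbers \<open>(b gchoose n) * v ^ n\<close> are the Fourier coefficients of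
  \<open>(1 + v * cis t) powr of_real b\<close>, whose squared modulus is the integrand; Parseval's
  identity applies.\<close>

lemma norm_one_plus_powr_mean:
  fixes v :: complex and b :: real
  assumes v: "norm v < 1"
  shows "(\<lambda>n. ((b gchoose n) * norm v ^ n)\<^sup>2) sums
    (1 / (2 * pi) * (LINT t|lebesgue_on {a..a + 2 * pi}. norm (1 + v * cis t) powr (2 * b)))"
proof -
  define d where "d n = (of_real b gchoose n) * v ^ n" for n
  \<comment> \<open>Convergence of the power series at a radius strictly between
    \<open>norm v\<close> and 1 yields absolute convergence at \<open>v\<close>.\<close>
  obtain \<rho> where \<rho>: "norm v < \<rho>" "\<rho> < 1"
    using dense[OF v] by blast
  have "0 < \<rho>" using \<rho>(1) norm_ge_zero[of v] by linarith
  then have "summable (\<lambda>n. (complex_of_real b gchoose n) * of_real \<rho> ^ n)"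
    using \<rho> by (intro sums_summable[OF gen_binomial_complex]) simp
  from powser_insidea[OF this, of v] have d: "summable (\<lambda>n. norm (d n))"
    using \<rho> by (simp add: d_def)
  have "(\<Sum>n. d n * cis (real n * t)) = (1 + v * cis t) powr of_real b" for t
    using gen_binomial_complex[of "v * cis t" "of_real b"] v
    by (simp add: d_def sums_iff norm_mult power_mult_distrib Complex.DeMoivre mult.assoc)
  then have "(norm (\<Sum>n. d n * cis (real n * t)))\<^sup>2 = norm (1 + v * cis t) powr (2 * b)" for t
    by (simp add: norm_powr_of_real powr_powr[symmetric] powr_realpow' power2_eq_square flip: powr_add)
  moreover have "complex_of_real b gchoose n = of_real (b gchoose n)" for n
    by (simp add: gbinomial_prod_rev)
  then have "norm (d n) = \<bar>b gchoose n\<bar> * norm v ^ n" for n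
    by (simp add: d_def norm_mult norm_power)
  ultimately show ?thesis
    using sums_square_norm_Fourier_coeffs[OF d, of a] by (simp add: power_mult_distrib)
qed

text \<open>Since \<open>b gchoose n\<close> is \<open>pochhammer (- b) n / fact n\<close> up to a
  sign, squaring removes the sign; one of the two factorials is
  \<open>pochhammer 1 n\<close>.\<close>

lemma norm_one_plus_powr_mean_gauss_F:
  fixes v :: complex and b :: real
  assumes v: "norm v < 1"
  shows "1 / (2 * pi) * (LINT t|lebesgue_on {a..a + 2 * pi}. norm (1 + v * cis t) powr (2 * b))
    = gauss_F (- b) (- b) 1 ((norm v)\<^sup>2)"
proof -
  have "((b gchoose n) * norm v ^ n)\<^sup>2
      = pochhammer (- b) n * pochhammer (- b) n / pochhammer 1 n * (((norm v)\<^sup>2) ^ n / fact n)" for n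
    by (simp add: gbinomial_pochhammer power_mult_distrib power_divide power2_eq_square
        flip: pochhammer_fact)
  then show ?thesis
    using norm_one_plus_powr_mean[OF v, of b a] by (simp add: gauss_F_def sums_iff)
qed

text \<open>Direct expansion would produce the parameters \<open>a\<close>, \<open>a\<close>. Under
  the change of angle \<open>\<phi>\<close>, the modulus of \<open>1 + v * cis (\<phi> t)\<close> is
  \<open>R / norm (u t)\<close> and the Jacobian is \<open>R / (norm (u t))\<^sup>2\<close>; this
  trades the exponent \<open>- (2 * a)\<close> for \<open>2 * (a - 1)\<close> and yields the
  parameters \<open>1 - a\<close>.\<close>

lemma norm_one_minus_powr_mean_gauss_F:
  fixes v :: complex and a :: real
  assumes v: "norm v < 1"
  shows "1 / (2 * pi) * (LINT t|lebesgue_on {0..2 * pi}. norm (1 - v * cis t) powr (- (2 * a)))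
    = (1 - (norm v)\<^sup>2) powr (1 - 2 * a) * gauss_F (1 - a) (1 - a) 1 ((norm v)\<^sup>2)"
proof -
  define R where "R = 1 - (norm v)\<^sup>2"
  define u where "u t = 1 - v * cis t" for t
  \<comment> \<open>\<open>cis (\<phi> t) = cis t (1 - cnj (v cis t)) / (1 - v cis t)\<close> is a disc automorphism on the circle,
    written with a continuous choice of the angle.\<close>
  define \<phi> where "\<phi> t = t - 2 * Im (Ln (u t))" for t
  define \<phi>' where "\<phi>' t = R / (norm (u t))\<^sup>2" for t
  define f where "f s = norm (1 + v * cis s) powr (2 * (a - 1))" for s
  have R: "R > 0"
    using v by (simp add: R_def power_less_one_iff abs_square_less_1)
  \<comment> \<open>The curve \<open>u\<close> stays in the right half-plane, so the principal
    logarithm is smooth along all of it and \<open>\<phi>\<close> has no jumps.\<close>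
  have Re_pos: "Re (u t) > 0" for t
  proof -
    have "Re (v * cis t) \<le> norm (v * cis t)" by (rule complex_Re_le_cmod)
    with v show ?thesis by (simp add: u_def norm_mult)
  qed
  then have u0: "u t \<noteq> 0" for t
    by (metis less_irrefl zero_complex.simps(1))
  have nonpos: "u t \<notin> \<real>\<^sub>\<le>\<^sub>0" for t
    using Re_pos[of t] complex_nonpos_Reals_iff by force
  have cis_\<phi>: "1 + v * cis (\<phi> t) = of_real R / u t" for t
  proof -
    have "cis (2 * Im (Ln (u t))) = (u t / norm (u t))\<^sup>2"
    proof -
      have "cis (Im (Ln (u t))) = u t / norm (u t)"
        using exp_Ln[OF u0[of t]] u0[of t] by (simp add: exp_eq_polar field_simps Re_Ln)
      then show ?thesis
        by (metis Complex.DeMoivre of_nat_numeral)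
    qed
    also have "\<dots> = u t / cnj (u t)"
      using u0[of t] by (simp add: power2_eq_square complex_norm_square[symmetric] power_divide
          divide_simps complex_mod_cnj)
    finally have c: "cis (\<phi> t) = cis t * cnj (u t) / u t"
      by (simp add: \<phi>_def flip: cis_divide)
    have "u t + v * cis t * cnj (u t) = 1 - (v * cis t) * cnj (v * cis t)"
      by (simp add: u_def algebra_simps)
    also have "\<dots> = of_real R"
      by (simp add: complex_norm_square[symmetric] R_def norm_mult del: complex_cnj_mult)
    finally show ?thesis
      using u0[of t] by (simp add: c field_simps)
  qed
  \<comment> \<open>The derivative of the boundary angle is the Poisson kernel: with
    \<open>y = v * cis t\<close>, the numerator over \<open>(norm (u t))\<^sup>2\<close> is
    \<open>(norm (1 - y))\<^sup>2 + 2 * Re (y * cnj (1 - y))\<close>, which equals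
    \<open>1 - (norm y)\<^sup>2\<close>.\<close>
  have deriv: "(\<phi> has_field_derivative \<phi>' t) (at t within S)" for t S
  proof -
    have "((\<lambda>z. Ln (1 - v * exp (\<i> * z))) has_field_derivative (- (\<i> * v * cis t) / u t)) (at (of_real t))"
      using nonpos[of t] unfolding u_def
      by (auto intro!: derivative_eq_intros simp: cis_conv_exp divide_inverse mult_ac)
    from has_vector_derivative_real_field[OF this]
    have "((\<lambda>t. Ln (u t)) has_vector_derivative (- (\<i> * v * cis t) / u t)) (at t within S)"
      by (simp add: u_def cis_conv_exp)
    from has_field_derivative_Im[OF this]
    have "((\<lambda>t. Im (Ln (u t))) has_field_derivative Im (- (\<i> * v * cis t) / u t)) (at t within S)" .
    then have "(\<phi> has_real_derivative (1 - 2 * Im (- (\<i> * v * cis t) / u t))) (at t within S)"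
      unfolding \<phi>_def by (intro DERIV_diff DERIV_ident DERIV_cmult)
    moreover have "1 - 2 * Im (- (\<i> * v * cis t) / u t) = \<phi>' t"
    proof -
      define y where "y = v * cis t"
      have "- (\<i> * v * cis t) / u t = - (\<i> * (y * cnj (1 - y))) / of_real ((norm (u t))\<^sup>2)"
        unfolding u_def y_def using u0[of t]
        by (subst complex_div_cnj) (simp add: u_def)
      then have "Im (- (\<i> * v * cis t) / u t) = - Re (y * cnj (1 - y)) / (norm (u t))\<^sup>2"
        by (simp only: Im_divide_of_real) simp
      moreover have "(norm (u t))\<^sup>2 + 2 * Re (y * cnj (1 - y)) = R"
      proof -
        have "(norm v)\<^sup>2 = (Re y)\<^sup>2 + (Im y)\<^sup>2"
          unfolding cmod_power2[symmetric] by (simp add: y_def norm_mult)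
        then show ?thesis
          unfolding R_def u_def y_def[symmetric] cmod_power2 by (simp add: power2_eq_square algebra_simps)
      qed
      ultimately show ?thesis
        using u0[of t] by (simp add: \<phi>'_def field_simps)
    qed
    ultimately show ?thesis by simp
  qed
  have \<phi>'_pos: "\<phi>' t > 0" for t
    using R u0[of t] by (simp add: \<phi>'_def)
  have mono: "\<phi> s \<le> \<phi> t" if "s \<le> t" for s t
    using that by (rule DERIV_nonneg_imp_nondecreasing) (use deriv \<phi>'_pos less_imp_le in blast)
  \<comment> \<open>As \<open>u\<close> is periodic, the logarithm contributes no increment, and
    \<open>\<phi>\<close> covers exactly one period, starting at \<open>\<phi> 0\<close>.\<close>
  have per: "\<phi> (2 * pi) = \<phi> 0 + 2 * pi"
    by (simp add: \<phi>_def u_def)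
  have pos: "1 + v * cis s \<noteq> 0" for s
    using v by (metis add.commute add_cancel_right_left add_eq_0_iff less_irrefl mult.right_neutral norm_cis norm_minus_cancel norm_mult norm_one)
  have cont_f: "continuous_on S f" for S
    unfolding f_def using pos by (intro continuous_intros) auto
  have "((\<lambda>t. \<phi>' t *\<^sub>R f (\<phi> t)) has_integral integral {\<phi> 0..\<phi> (2 * pi)} f) {0..2 * pi}"
    by (rule has_integral_substitution[where c = "\<phi> 0" and d = "\<phi> (2 * pi)"])
       (use mono deriv cont_f in auto)
  moreover have "\<phi>' t *\<^sub>R f (\<phi> t) = R powr (2 * a - 1) * norm (u t) powr (- (2 * a))" for t
  proof -
    have "f (\<phi> t) = (R / norm (u t)) powr (2 * (a - 1))"
      using R by (simp add: f_def cis_\<phi> norm_divide)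
    also have "\<dots> = R powr (2 * (a - 1)) * norm (u t) powr (- (2 * (a - 1)))"
      using powr_divide[of R "norm (u t)" "2 * (a - 1)"] R
      by (simp only: powr_minus divide_inverse norm_ge_zero less_imp_le)
    finally have "\<phi>' t *\<^sub>R f (\<phi> t) = (R powr 1 * R powr (2 * (a - 1))) *
        (norm (u t) powr (- 2) * norm (u t) powr (- (2 * (a - 1))))"
      using R u0[of t] by (simp add: \<phi>'_def powr_minus_divide)
    then show ?thesis
      by (simp only: powr_add[symmetric]) (simp add: algebra_simps)
  qed
  ultimately have "((\<lambda>t. R powr (2 * a - 1) * norm (u t) powr (- (2 * a))) has_integral
      integral {\<phi> 0..\<phi> 0 + 2 * pi} f) {0..2 * pi}"
    by (simp add: per)
  then have "R powr (2 * a - 1) * integral {0..2 * pi} (\<lambda>t. norm (u t) powr (- (2 * a)))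
      = integral {\<phi> 0..\<phi> 0 + 2 * pi} f"
    by (simp add: integral_unique flip: integral_mult_right)
  moreover have "continuous_on {0..2 * pi} (\<lambda>t. norm (u t) powr (- (2 * a)))"
    using u0 unfolding u_def by (intro continuous_intros) auto
  ultimately have "R powr (2 * a - 1) * (LINT t|lebesgue_on {0..2 * pi}. norm (u t) powr (- (2 * a)))
      = (LINT s|lebesgue_on {\<phi> 0..\<phi> 0 + 2 * pi}. f s)"
    by (simp only: LINT_continuous_lebesgue_on cont_f)
  then have "R powr (2 * a - 1) * (1 / (2 * pi) * (LINT t|lebesgue_on {0..2 * pi}. norm (u t) powr (- (2 * a))))
      = gauss_F (1 - a) (1 - a) 1 ((norm v)\<^sup>2)" (is "_ * ?m = ?G")
    using norm_one_plus_powr_mean_gauss_F[OF v, of "\<phi> 0" "a - 1"] by (simp add: f_def)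
  moreover have "R powr (1 - 2 * a) * R powr (2 * a - 1) = 1"
    using R by (simp flip: powr_add)
  then have "?m = R powr (1 - 2 * a) * (R powr (2 * a - 1) * ?m)"
    by (simp only: mult.assoc[symmetric] mult_1_left)
  ultimately have "?m = R powr (1 - 2 * a) * ?G"
    by (simp only:)
  then show ?thesis
    by (simp only: u_def R_def)
qed

subsection \<open>Hoelder's inequality and differentiation under the integral\<close>

text \<open>Young's inequality gives integrability of the product and, after both functions are
  divided by their norms, the estimate. If one norm vanishes, that function is zero almost
  everywhere and so is the product.\<close>

lemma Holder_inequality_nonneg:
  fixes f g :: "'a \<Rightarrow> real"
  assumes pq: "p > 1" "q > 1" "1 / p + 1 / q = 1"
    and meas [measurable]: "f \<in> borel_measurable M" "g \<in> borel_measurable M"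
    and nonneg: "\<And>x. f x \<ge> 0" "\<And>x. g x \<ge> 0"
    and int: "integrable M (\<lambda>x. f x powr p)" "integrable M (\<lambda>x. g x powr q)"
  shows "integrable M (\<lambda>x. f x * g x)"
    and "(LINT x|M. f x * g x) \<le> (LINT x|M. f x powr p) powr (1 / p) * (LINT x|M. g x powr q) powr (1 / q)"
proof -
  show fg: "integrable M (\<lambda>x. f x * g x)"
  proof (rule Bochner_Integration.integrable_bound)
    show "integrable M (\<lambda>x. f x powr p / p + g x powr q / q)"
      using int by simp
    show "AE x in M. norm (f x * g x) \<le> norm (f x powr p / p + g x powr q / q)"
      using Youngs_inequality[OF pq nonneg] nonneg pq by (auto simp: abs_of_nonneg)
  qed measurable
  define A where "A = (LINT x|M. f x powr p)"
  define B where "B = (LINT x|M. g x powr q)"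
  have AB: "A \<ge> 0" "B \<ge> 0"
    unfolding A_def B_def by (simp_all add: integral_nonneg_AE)
  show "(LINT x|M. f x * g x) \<le> A powr (1 / p) * B powr (1 / q)"
  proof (cases "A = 0 \<or> B = 0")
    case True
    then have "(AE x in M. f x powr p = 0) \<or> (AE x in M. g x powr q = 0)"
      unfolding A_def B_def
      using integral_nonneg_eq_0_iff_AE[OF int(1)] integral_nonneg_eq_0_iff_AE[OF int(2)] by auto
    then have "AE x in M. f x * g x = 0"
      by (auto elim: eventually_mono)
    then have "(LINT x|M. f x * g x) = 0"
      by (rule integral_eq_zero_AE)
    then show ?thesis by simp
  next
    case False
    with AB have AB: "A > 0" "B > 0" by auto
    define a where "a = A powr (1 / p)"
    define b where "b = B powr (1 / q)"
    have ab: "a > 0" "b > 0" "a powr p = A" "b powr q = B"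
      using AB pq by (auto simp: a_def b_def powr_powr)
    have le: "f x * g x / (a * b) \<le> f x powr p / (A * p) + g x powr q / (B * q)" for x
      using Youngs_inequality[OF pq, of "f x / a" "g x / b"] nonneg[of x] ab
      by (simp add: powr_divide)
    have "(LINT x|M. f x * g x / (a * b)) \<le> (LINT x|M. f x powr p / (A * p) + g x powr q / (B * q))"
      using fg int le by (intro integral_mono) auto
    also have "\<dots> = 1"
      using int AB pq by (simp flip: A_def B_def)
    finally show ?thesis
      using ab by (simp add: field_simps flip: a_def b_def)
  qed
qed

text \<open>Difference quotients can be tested along sequences, which is the form that dominated
  convergence needs.\<close>

lemma has_vector_derivative_at_0_iff:
  "(f has_vector_derivative d) (at 0) \<longleftrightarrow> ((\<lambda>s. (f s - f 0) /\<^sub>R s) \<longlongrightarrow> d) (at 0)"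
proof -
  have "eventually (\<lambda>h. norm (f h - f 0 - h *\<^sub>R d) / norm h = norm ((f h - f 0) /\<^sub>R h - d)) (at 0)"
  proof (rule eventually_at_filter[THEN iffD2], rule always_eventually, intro allI impI)
    fix h :: real
    assume "h \<noteq> 0"
    then have "(f h - f 0) /\<^sub>R h - d = (f h - f 0 - h *\<^sub>R d) /\<^sub>R h"
      by (simp add: algebra_simps)
    then show "norm (f h - f 0 - h *\<^sub>R d) / norm h = norm ((f h - f 0) /\<^sub>R h - d)"
      by (simp add: divide_inverse mult.commute)
  qed
  from tendsto_cong[OF this, of 0] show ?thesis
    unfolding has_vector_derivative_def has_derivative_at
    by (simp add: bounded_linear_scaleR_left tendsto_norm_zero_iff LIM_zero_iff)
qed

text \<open>By the mean value inequality, \<open>B\<close> dominates the difference quotients;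
  dominated convergence then passes to the limit.\<close>

lemma has_vector_derivative_LINT:
  fixes g :: "real \<Rightarrow> 'a \<Rightarrow> 'b::{banach, second_countable_topology}"
  assumes "\<delta> > 0"
    and int: "\<And>s. \<bar>s\<bar> < \<delta> \<Longrightarrow> integrable M (g s)"
    and deriv: "\<And>s x. \<bar>s\<bar> < \<delta> \<Longrightarrow> x \<in> space M \<Longrightarrow>
      ((\<lambda>s. g s x) has_vector_derivative g' s x) (at s)"
    and bound: "\<And>s x. \<bar>s\<bar> < \<delta> \<Longrightarrow> x \<in> space M \<Longrightarrow> norm (g' s x) \<le> B x"
    and B: "integrable M B"
  shows "((\<lambda>s. LINT x|M. g s x) has_vector_derivative (LINT x|M. g' 0 x)) (at 0)"
proof -
  define D where "D s x = (g s x - g 0 x) /\<^sub>R s" for s x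
  have D_le: "norm (D s x) \<le> B x" if s: "\<bar>s\<bar> < \<delta>" "s \<noteq> 0" and x: "x \<in> space M" for s x
  proof -
    have "norm (g s x - g 0 x) \<le> B x * norm (s - 0)"
    proof (rule differentiable_bound)
      show "convex {-\<bar>s\<bar>..\<bar>s\<bar>}" by simp
      fix t assume "t \<in> {-\<bar>s\<bar>..\<bar>s\<bar>}"
      then have t: "\<bar>t\<bar> < \<delta>" using s by auto
      show "((\<lambda>s. g s x) has_derivative (\<lambda>h. h *\<^sub>R g' t x)) (at t within {-\<bar>s\<bar>..\<bar>s\<bar>})"
        using deriv[OF t x] has_derivative_at_withinI unfolding has_vector_derivative_def by blast
      show "onorm (\<lambda>h. h *\<^sub>R g' t x) \<le> B x"
        using bound[OF t x] by (intro onorm_le) (auto simp: mult.commute[of "B x"] intro: mult_left_mono)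
    qed auto
    moreover have "norm (D s x) = norm (g s x - g 0 x) / \<bar>s\<bar>"
      by (simp add: D_def divide_inverse mult.commute)
    ultimately show ?thesis
      using s by (simp add: pos_divide_le_eq)
  qed
  have D_tendsto: "(\<lambda>n. D (X n) x) \<longlonglongrightarrow> g' 0 x"
    if x: "x \<in> space M" and X: "X \<longlonglongrightarrow> 0" "\<And>n. X n \<noteq> 0" for X x
  proof -
    have "((\<lambda>s. D s x) \<longlongrightarrow> g' 0 x) (at 0)"
      using deriv[of 0 x] \<open>\<delta> > 0\<close> x
      unfolding has_vector_derivative_at_0_iff D_def
      by simp
    with X show ?thesis
      by (auto simp: tendsto_at_iff_sequentially o_def)
  qed
  have key: "(\<lambda>n. LINT x|M. D (X n) x) \<longlonglongrightarrow> (LINT x|M. g' 0 x)"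
    if X: "X \<longlonglongrightarrow> 0" "\<And>n. X n \<noteq> 0" for X
  proof -
    \<comment> \<open>A null sequence is within \<open>\<delta>\<close> of 0 only eventually;
      dropping its first \<open>N\<close> terms makes the bound hold for every index.\<close>
    obtain N where N: "\<bar>X n\<bar> < \<delta>" if "n \<ge> N" for n
      using LIMSEQ_D[OF X(1) \<open>\<delta> > 0\<close>] by auto
    define Y where "Y n = X (n + N)" for n
    have Y: "Y \<longlonglongrightarrow> 0" "\<And>n. Y n \<noteq> 0" "\<And>n. \<bar>Y n\<bar> < \<delta>"
      using X N LIMSEQ_ignore_initial_segment[OF X(1), of N] by (auto simp: Y_def[abs_def])
    have D_meas: "D (Y n) \<in> borel_measurable M" for n
      unfolding D_def using int[OF Y(3)] int[of 0] \<open>\<delta> > 0\<close> by auto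
    have "(\<lambda>n. LINT x|M. D (Y n) x) \<longlonglongrightarrow> (LINT x|M. g' 0 x)"
    proof (rule integral_dominated_convergence)
      \<comment> \<open>Measurability of the derivative is inherited from the difference quotients
        as their pointwise limit.\<close>
      show "g' 0 \<in> borel_measurable M"
        by (rule borel_measurable_LIMSEQ_metric[where f = "\<lambda>n. D (Y n)"]) (use D_meas D_tendsto Y in auto)
      show "AE x in M. (\<lambda>n. D (Y n) x) \<longlonglongrightarrow> g' 0 x"
        using D_tendsto Y by auto
      show "AE x in M. norm (D (Y n) x) \<le> B x" for n
        using D_le Y by auto
    qed (use D_meas B in auto)
    then show ?thesis
      unfolding Y_def by (rule LIMSEQ_offset)
  qed
  have "((\<lambda>s. LINT x|M. D s x) \<longlongrightarrow> (LINT x|M. g' 0 x)) (at 0)"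
    using key by (auto simp: tendsto_at_iff_sequentially o_def)
  moreover have "eventually (\<lambda>s. (LINT x|M. D s x) = ((LINT x|M. g s x) - (LINT x|M. g 0 x)) /\<^sub>R s) (at 0)"
    unfolding eventually_at
    by (rule exI[of _ \<delta>]) (use \<open>\<delta> > 0\<close> int in \<open>auto simp: D_def[abs_def] dist_norm Bochner_Integration.integral_diff\<close>)
  ultimately have "((\<lambda>s. ((LINT x|M. g s x) - (LINT x|M. g 0 x)) /\<^sub>R s) \<longlongrightarrow> (LINT x|M. g' 0 x)) (at 0)"
    by (rule Lim_transform_eventually)
  then show ?thesis
    unfolding has_vector_derivative_at_0_iff by simp
qed

subsection \<open>The kernel and its Wirtinger derivatives\<close>

text \<open>The Wirtinger derivative of the kernel in \<open>u\<close>, with its logarithmic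
  derivative put over one denominator. Both terms of the numerator carry a factor of modulus
  \<open>norm (1 - u)\<close>, which cancels against the denominator in estimates.\<close>

definition K_dz :: "complex \<Rightarrow> complex \<Rightarrow> complex \<Rightarrow> complex" where
  "K_dz \<alpha> \<beta> u = K_kernel \<alpha> \<beta> u * (((\<alpha> + 1) * (1 - cnj u) - \<beta> * cnj u * (1 - u))
      / (of_real (1 - (norm u)\<^sup>2) * (1 - u)))"

definition K_dcnj :: "complex \<Rightarrow> complex \<Rightarrow> complex \<Rightarrow> complex" where
  "K_dcnj \<alpha> \<beta> u = K_kernel \<alpha> \<beta> u * (((\<beta> + 1) * (1 - u) - \<alpha> * u * (1 - cnj u))
      / (of_real (1 - (norm u)\<^sup>2) * (1 - cnj u)))"

section \<open>The kernel as a single exponential, and its size\<close>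

context
  fixes u :: complex
  assumes u: "norm u < 1"
begin

lemma one_minus_square_norm_pos: "1 - (norm u)\<^sup>2 > 0"
  using u by (simp add: power_less_one_iff abs_square_less_1)

lemma Re_one_minus_pos: "Re (1 - u) > 0" "Re (1 - cnj u) > 0"
  using u complex_Re_le_cmod[of u] by auto

lemma one_minus_not_nonpos: "1 - u \<notin> \<real>\<^sub>\<le>\<^sub>0" "1 - cnj u \<notin> \<real>\<^sub>\<le>\<^sub>0"
  using Re_one_minus_pos complex_nonpos_Reals_iff by force+

lemma one_minus_nonzero: "1 - u \<noteq> 0" "1 - cnj u \<noteq> 0"
  using one_minus_not_nonpos by force+

lemma of_real_one_minus_square_norm: "complex_of_real (1 - (norm u)\<^sup>2) = 1 - u * cnj u"
  by (simp add: complex_norm_square del: of_real_power)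

lemma one_minus_mult_cnj_not_nonpos: "1 - u * cnj u \<notin> \<real>\<^sub>\<le>\<^sub>0"
  using one_minus_square_norm_pos
  unfolding of_real_one_minus_square_norm[symmetric] complex_nonpos_Reals_iff Re_complex_of_real by simp

text \<open>All three logarithms avoid the branch cut inside the disc, so modulus, derivative and
  continuity of the kernel can be read off from one exponent.\<close>

lemma K_kernel_eq_exp:
  "K_kernel \<alpha> \<beta> u = c_coeff \<alpha> \<beta> * exp ((\<alpha> + \<beta> + 1) * Ln (1 - u * cnj u)
      - (\<alpha> + 1) * Ln (1 - u) - (\<beta> + 1) * Ln (1 - cnj u))"
proof -
  have "1 - u * cnj u \<noteq> 0"
    using one_minus_mult_cnj_not_nonpos by force
  then show ?thesis
    unfolding K_kernel_def of_real_one_minus_square_norm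
    using one_minus_nonzero by (simp add: powr_def exp_diff)
qed

text \<open>The logarithms of \<open>1 - u\<close> and \<open>1 - cnj u\<close> are conjugate, so
  their imaginary parts enter only through \<open>Im (\<alpha> - \<beta>) * Im L\<close>; the
  half-plane bound on the argument turns this into the exponential factor.\<close>

lemma norm_K_kernel_le:
  "norm (K_kernel \<alpha> \<beta> u) \<le> norm (c_coeff \<alpha> \<beta>) * exp (pi / 2 * \<bar>Im (\<alpha> - \<beta>)\<bar>)
     * (1 - (norm u)\<^sup>2) powr (Re (\<alpha> + \<beta>) + 1) * norm (1 - u) powr (- (Re (\<alpha> + \<beta>) + 2))"
proof -
  define L where "L = Ln (1 - u)"
  define R where "R = 1 - (norm u)\<^sup>2"
  have R: "R > 0" using one_minus_square_norm_pos by (simp add: R_def)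
  have L': "Ln (1 - cnj u) = cnj L"
    unfolding L_def using cnj_Ln[OF one_minus_not_nonpos(1)] by simp
  have LR: "Ln (1 - u * cnj u) = of_real (ln R)"
    unfolding of_real_one_minus_square_norm[symmetric] R_def[symmetric] using R by (rule Ln_of_real)
  have ReL: "Re L = ln (norm (1 - u))"
    unfolding L_def using one_minus_nonzero by (simp add: Re_Ln)
  have "\<bar>Im L\<bar> \<le> pi / 2"
    unfolding L_def using Re_Ln_pos_lt_imp[OF Re_one_minus_pos(1)] by simp
  then have "Im (\<alpha> - \<beta>) * Im L \<le> pi / 2 * \<bar>Im (\<alpha> - \<beta>)\<bar>"
    by (metis abs_ge_zero abs_le_D1 abs_mult mult.commute mult_right_mono)
  then have "Re ((\<alpha> + \<beta> + 1) * Ln (1 - u * cnj u) - (\<alpha> + 1) * L - (\<beta> + 1) * cnj L)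
      \<le> pi / 2 * \<bar>Im (\<alpha> - \<beta>)\<bar> + (Re (\<alpha> + \<beta>) + 1) * ln R - (Re (\<alpha> + \<beta>) + 2) * ln (norm (1 - u))"
    by (simp add: LR ReL algebra_simps)
  then have "norm (exp ((\<alpha> + \<beta> + 1) * Ln (1 - u * cnj u) - (\<alpha> + 1) * L - (\<beta> + 1) * cnj L))
     \<le> exp (pi / 2 * \<bar>Im (\<alpha> - \<beta>)\<bar> + (Re (\<alpha> + \<beta>) + 1) * ln R - (Re (\<alpha> + \<beta>) + 2) * ln (norm (1 - u)))"
    by simp
  also have "\<dots> = exp (pi / 2 * \<bar>Im (\<alpha> - \<beta>)\<bar>) * (R powr (Re (\<alpha> + \<beta>) + 1)
      * norm (1 - u) powr (- (Re (\<alpha> + \<beta>) + 2)))"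
    using R one_minus_nonzero by (simp add: powr_def flip: exp_add) (simp add: algebra_simps)
  finally show ?thesis
    unfolding K_kernel_eq_exp L' L_def[symmetric] R_def[symmetric] norm_mult
    by (simp add: mult_left_mono mult.assoc)
qed

lemma norm_K_dz_le:
  "norm (K_dz \<alpha> \<beta> u) \<le> norm (K_kernel \<alpha> \<beta> u) / (1 - (norm u)\<^sup>2) * (norm (\<alpha> + 1) + norm \<beta> * norm u)"
proof -
  have n: "norm (1 - cnj u) = norm (1 - u)"
    by (metis complex_cnj_diff complex_cnj_one complex_mod_cnj)
  have "norm ((\<alpha> + 1) * (1 - cnj u) - \<beta> * cnj u * (1 - u)) \<le> (norm (\<alpha> + 1) + norm \<beta> * norm u) * norm (1 - u)"
    by (rule order_trans[OF norm_triangle_ineq4]) (simp add: norm_mult n distrib_right[of "norm (\<alpha> + 1)"])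
  then have "norm (((\<alpha> + 1) * (1 - cnj u) - \<beta> * cnj u * (1 - u)) / (of_real (1 - (norm u)\<^sup>2) * (1 - u)))
      \<le> (norm (\<alpha> + 1) + norm \<beta> * norm u) / (1 - (norm u)\<^sup>2)"
    using one_minus_square_norm_pos one_minus_nonzero
    by (simp add: norm_divide norm_mult divide_simps mult_ac del: of_real_diff)
  then show ?thesis
    unfolding K_dz_def norm_mult by (metis mult_left_mono norm_ge_zero times_divide_eq_left times_divide_eq_right)
qed

end

text \<open>Conjugating the variable exchanges \<alpha> and \<beta>; bounds and continuity for
  \<open>K_dcnj\<close> are thereby inherited from \<open>K_dz\<close>.\<close>

lemma K_dcnj_eq: "K_dcnj \<alpha> \<beta> u = K_dz \<beta> \<alpha> (cnj u)"
  by (simp add: K_dcnj_def K_dz_def K_kernel_def c_coeff_def mult.commute add.commute)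

text \<open>The kernel is not holomorphic, so the chain rule is taken along a real curve; the
  coefficients of \<open>g'\<close> and \<open>cnj g'\<close> are the two Wirtinger
  derivatives.\<close>

lemma has_vector_derivative_K_kernel:
  assumes g: "(g has_vector_derivative g') (at s)" and u: "norm (g s) < 1"
  shows "((\<lambda>s. K_kernel \<alpha> \<beta> (g s)) has_vector_derivative
    (K_dz \<alpha> \<beta> (g s) * g' + K_dcnj \<alpha> \<beta> (g s) * cnj g')) (at s)"
proof -
  have Ln: "((\<lambda>s. Ln (h s)) has_vector_derivative (h' / h s)) (at s)"
    if "(h has_vector_derivative h') (at s)" "h s \<notin> \<real>\<^sub>\<le>\<^sub>0" for h h'
    using field_vector_diff_chain_at[OF that(1) has_field_derivative_Ln[OF that(2)]]
    by (simp add: o_def divide_inverse)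
  have gc: "((\<lambda>s. cnj (g s)) has_vector_derivative cnj g') (at s)"
    by (rule has_vector_derivative_cnj[OF g])
  have 1: "((\<lambda>s. 1 - g s) has_vector_derivative - g') (at s)"
    using has_vector_derivative_diff[OF has_vector_derivative_const g, of 1] by simp
  have 2: "((\<lambda>s. 1 - cnj (g s)) has_vector_derivative - cnj g') (at s)"
    using has_vector_derivative_diff[OF has_vector_derivative_const gc, of 1] by simp
  have 3: "((\<lambda>s. 1 - g s * cnj (g s)) has_vector_derivative - (g s * cnj g' + g' * cnj (g s))) (at s)"
    using has_vector_derivative_diff[OF has_vector_derivative_const has_vector_derivative_mult[OF g gc], of 1] by simp
  define E where "E s = (\<alpha> + \<beta> + 1) * Ln (1 - g s * cnj (g s))
      - (\<alpha> + 1) * Ln (1 - g s) - (\<beta> + 1) * Ln (1 - cnj (g s))" for s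
  define E' where "E' = (\<alpha> + \<beta> + 1) * (- (g s * cnj g' + g' * cnj (g s)) / (1 - g s * cnj (g s)))
      - (\<alpha> + 1) * (- g' / (1 - g s)) - (\<beta> + 1) * (- cnj g' / (1 - cnj (g s)))"
  have "(E has_vector_derivative E') (at s)"
    unfolding E_def E'_def
    by (intro has_vector_derivative_diff has_vector_derivative_mult_right Ln 1 2 3
        one_minus_not_nonpos[OF u] one_minus_mult_cnj_not_nonpos[OF u])
  from field_vector_diff_chain_at[OF this DERIV_exp]
  have "((\<lambda>s. exp (E s)) has_vector_derivative (E' * exp (E s))) (at s)"
    by (simp add: o_def)
  from has_vector_derivative_mult_right[OF this, of "c_coeff \<alpha> \<beta>"]
  have "((\<lambda>s. c_coeff \<alpha> \<beta> * exp (E s)) has_vector_derivative (E' * K_kernel \<alpha> \<beta> (g s))) (at s)"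
    unfolding K_kernel_eq_exp[OF u] E_def by (simp add: mult_ac)
  \<comment> \<open>The exponential form is available only inside the disc. By continuity
    \<open>g\<close> remains there near \<open>s\<close>, and local equality transfers the
    derivative.\<close>
  moreover have "eventually (\<lambda>s. c_coeff \<alpha> \<beta> * exp (E s) = K_kernel \<alpha> \<beta> (g s)) (nhds s)"
  proof -
    have "((\<lambda>t. norm (g t)) \<longlongrightarrow> norm (g s)) (nhds s)"
      using has_vector_derivative_continuous[OF g]
      by (intro tendsto_norm) (simp add: continuous_at tendsto_at_iff_tendsto_nhds)
    then have "eventually (\<lambda>t. norm (g t) < 1) (nhds s)"
      using u by (rule order_tendstoD)
    then show ?thesis
      by eventually_elim (simp add: K_kernel_eq_exp E_def)
  qed
  moreover from eventually_nhds_x_imp_x[OF this]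
  have "c_coeff \<alpha> \<beta> * exp (E s) = K_kernel \<alpha> \<beta> (g s)" .
  ultimately have "((\<lambda>s. K_kernel \<alpha> \<beta> (g s)) has_vector_derivative (E' * K_kernel \<alpha> \<beta> (g s))) (at s)"
    by (subst (asm) has_vector_derivative_cong_ev) (auto elim: eventually_mono)
  moreover have "E' * K_kernel \<alpha> \<beta> (g s) = K_dz \<alpha> \<beta> (g s) * g' + K_dcnj \<alpha> \<beta> (g s) * cnj g'"
  proof -
    define v where "v = g s"
    define R where "R = 1 - v * cnj v"
    have nz: "1 - v \<noteq> 0" "1 - cnj v \<noteq> 0" "R \<noteq> 0"
      using one_minus_nonzero[OF u] one_minus_mult_cnj_not_nonpos[OF u] by (force simp: v_def R_def)+
    have "(\<alpha> + 1) / (1 - v) - (\<alpha> + \<beta> + 1) * cnj v / R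
        = ((\<alpha> + 1) * R - (\<alpha> + \<beta> + 1) * cnj v * (1 - v)) / (R * (1 - v))"
      using nz by (simp add: diff_frac_eq mult_ac)
    \<comment> \<open>The identity behind this is
      \<open>R - cnj v * (1 - v) = 1 - cnj v\<close>.\<close>
    also have "(\<alpha> + 1) * R - (\<alpha> + \<beta> + 1) * cnj v * (1 - v) = (\<alpha> + 1) * (1 - cnj v) - \<beta> * cnj v * (1 - v)"
      by (simp add: R_def algebra_simps)
    finally have z: "K_dz \<alpha> \<beta> v = K_kernel \<alpha> \<beta> v * ((\<alpha> + 1) / (1 - v) - (\<alpha> + \<beta> + 1) * cnj v / R)"
      unfolding K_dz_def of_real_one_minus_square_norm[OF u, folded v_def] R_def by simp
    have "(\<beta> + 1) / (1 - cnj v) - (\<alpha> + \<beta> + 1) * v / R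
        = ((\<beta> + 1) * R - (\<alpha> + \<beta> + 1) * v * (1 - cnj v)) / (R * (1 - cnj v))"
      using nz by (simp add: diff_frac_eq mult_ac)
    also have "(\<beta> + 1) * R - (\<alpha> + \<beta> + 1) * v * (1 - cnj v) = (\<beta> + 1) * (1 - v) - \<alpha> * v * (1 - cnj v)"
      by (simp add: R_def algebra_simps)
    finally have c: "K_dcnj \<alpha> \<beta> v = K_kernel \<alpha> \<beta> v * ((\<beta> + 1) / (1 - cnj v) - (\<alpha> + \<beta> + 1) * v / R)"
      unfolding K_dcnj_def of_real_one_minus_square_norm[OF u, folded v_def] R_def by simp
    show ?thesis
      unfolding E'_def v_def[symmetric] R_def[symmetric] z c
      by (simp add: divide_inverse algebra_simps)
  qed
  ultimately show ?thesis by simp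
qed

lemma continuous_on_K_kernel: "continuous_on (ball 0 1) (K_kernel \<alpha> \<beta>)"
proof -
  have "continuous_on (ball 0 1) (\<lambda>u. c_coeff \<alpha> \<beta> * exp ((\<alpha> + \<beta> + 1) * Ln (1 - u * cnj u)
      - (\<alpha> + 1) * Ln (1 - u) - (\<beta> + 1) * Ln (1 - cnj u)))"
    by (intro continuous_intros)
       (auto simp: one_minus_not_nonpos one_minus_mult_cnj_not_nonpos)
  then show ?thesis
    by (rule continuous_on_eq) (simp add: K_kernel_eq_exp)
qed

lemma continuous_on_K_dz: "continuous_on (ball 0 1) (K_dz \<alpha> \<beta>)"
proof -
  have nz: "complex_of_real (1 - (norm u)\<^sup>2) * (1 - u) \<noteq> 0" if "u \<in> ball 0 1" for u
    using that one_minus_square_norm_pos[of u] one_minus_nonzero[of u]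
    by (metis mem_ball_0 mult_eq_0_iff of_real_eq_0_iff less_irrefl)
  show ?thesis
    unfolding K_dz_def using nz by (intro continuous_intros continuous_on_K_kernel) auto
qed

lemma continuous_on_K_dcnj: "continuous_on (ball 0 1) (K_dcnj \<alpha> \<beta>)"
proof -
  have "continuous_on (ball 0 1) (\<lambda>u. K_dz \<beta> \<alpha> (cnj u))"
    by (rule continuous_on_compose2[OF continuous_on_K_dz]) (auto intro!: continuous_intros)
  then show ?thesis
    by (simp add: K_dcnj_eq[abs_def])
qed

subsection \<open>Derivatives of the integral\<close>

lemma integrable_arc_continuous_mult:
  fixes g h :: "real \<Rightarrow> complex"
  assumes g: "integrable arc g" and h: "continuous_on {0..2 * pi} h"
  shows "integrable arc (\<lambda>t. h t * g t)"
proof -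
  have "bounded (h ` {0..2 * pi})"
    by (intro compact_imp_bounded compact_continuous_image h compact_Icc)
  then obtain C where C: "\<forall>t\<in>{0..2 * pi}. norm (h t) \<le> C"
    by (auto simp: bounded_iff)
  have [measurable]: "h \<in> borel_measurable arc" "g \<in> borel_measurable arc"
    using integrable_continuous_lebesgue_on[OF h] g by auto
  show ?thesis
  proof (rule Bochner_Integration.integrable_bound)
    show "integrable arc (\<lambda>t. C * norm (g t))"
      using g by simp
    show "AE t in arc. norm (h t * g t) \<le> norm (C * norm (g t))"
    proof (rule AE_I2)
      fix t assume "t \<in> space arc"
      then have "norm (h t) \<le> C" using C by simp
      then have "norm (h t) * norm (g t) \<le> \<bar>C\<bar> * norm (g t)"
        by (intro mult_right_mono) auto
      then show "norm (h t * g t) \<le> norm (C * norm (g t))"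
        by (simp add: norm_mult abs_mult)
    qed
  qed measurable
qed

lemma continuous_on_rotate:
  assumes "continuous_on (ball 0 1) F" and "norm z < 1"
  shows "continuous_on A (\<lambda>t. F (z * cis (- t)))"
  using assms(2)
  by (intro continuous_on_compose2[OF assms(1)] continuous_intros) (auto simp: norm_mult)

text \<open>Supplies the constants that dominate the differentiated integrand uniformly in the
  angle.\<close>

lemma bounded_image_cball:
  fixes F :: "complex \<Rightarrow> complex"
  assumes "continuous_on (ball 0 1) F" and "\<rho> < 1"
  obtains C where "\<And>u. norm u \<le> \<rho> \<Longrightarrow> norm (F u) \<le> C"
proof -
  have "continuous_on (cball 0 \<rho>) F"
    using assms by (auto intro: continuous_on_subset)
  then have "bounded (F ` cball 0 \<rho>)"
    by (intro compact_imp_bounded compact_continuous_image) auto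
  then obtain C where "\<forall>u\<in>cball 0 \<rho>. norm (F u) \<le> C"
    by (auto simp: bounded_iff)
  then show ?thesis
    by (intro that[of C]) auto
qed

text \<open>What remains of the estimates once factors depending only on \<open>norm z\<close> are
  pulled out. For \<open>s = 2\<close> it is the Poisson integral of the modulus of
  \<open>f\<close>, divided by \<open>1 - (norm z)\<^sup>2\<close>.\<close>

definition Poisson_mean :: "(complex \<Rightarrow> complex) \<Rightarrow> complex \<Rightarrow> real \<Rightarrow> real" where
  "Poisson_mean f z s =
     1 / (2 * pi) * (LINT t|arc. norm (1 - z * cis (- t)) powr (- s) * norm (f (cis t)))"

lemma one_minus_rotate_nonzero: "norm z < 1 \<Longrightarrow> 1 - z * cis (- t) \<noteq> 0"
  by (intro one_minus_nonzero) (simp add: norm_mult)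

lemma mean_powr_eq_gauss_F:
  assumes "norm z < 1"
  shows "1 / (2 * pi) * (LINT t|arc. norm (1 - z * cis (- t)) powr (- s))
    = (1 - (norm z)\<^sup>2) powr (1 - s) * gauss_F (1 - s / 2) (1 - s / 2) 1 ((norm z)\<^sup>2)"
proof -
  have "norm (1 - z * cis (- t)) = norm (1 - cnj z * cis t)" for t
  proof -
    have "1 - cnj z * cis t = cnj (1 - z * cis (- t))"
      by (simp add: cis_cnj)
    then show ?thesis
      by (simp only: complex_mod_cnj)
  qed
  then show ?thesis
    using norm_one_minus_powr_mean_gauss_F[of "cnj z" "s / 2"] assms by simp
qed

section \<open>Differentiation of the integral for integrable boundary data\<close>

context
  fixes f :: "complex \<Rightarrow> complex" and z :: complex
  assumes f: "integrable arc (\<lambda>t. f (cis t))" and z: "norm z < 1"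
begin

lemma integrable_rotate_mult:
  assumes "continuous_on (ball 0 1) F"
  shows "integrable arc (\<lambda>t. F (z * cis (- t)) * cis (c * t) * f (cis t))"
  by (intro integrable_arc_continuous_mult f continuous_intros continuous_on_rotate assms z)

text \<open>An arbitrary direction \<open>h\<close> treats both partial derivatives at once.\<close>

lemma has_vector_derivative_K_integral:
  "((\<lambda>s. K_integral \<alpha> \<beta> f (z + h * of_real s)) has_vector_derivative
    (h * (1 / (2 * of_real pi) * (LINT t|arc. K_dz \<alpha> \<beta> (z * cis (- t)) * cis (- t) * f (cis t)))
     + cnj h * (1 / (2 * of_real pi) * (LINT t|arc. K_dcnj \<alpha> \<beta> (z * cis (- t)) * cis t * f (cis t))))) (at 0)"
proof -
  \<comment> \<open>The radius \<open>\<rho>\<close> lies midway between \<open>norm z\<close> and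
    1, and \<open>\<delta>\<close> keeps \<open>z + h * of_real s\<close> within it. The summand 1
    in the denominator of \<open>\<delta>\<close> covers \<open>h = 0\<close>.\<close>
  define \<rho> where "\<rho> = (1 + norm z) / 2"
  define \<delta> where "\<delta> = (1 - norm z) / (2 * (norm h + 1))"
  have \<rho>: "\<rho> < 1" using z by (simp add: \<rho>_def)
  have \<delta>: "\<delta> > 0" using z by (simp add: \<delta>_def add_nonneg_pos)
  have inside: "norm (z + h * of_real s) \<le> \<rho>" if s: "\<bar>s\<bar> < \<delta>" for s
  proof -
    have "norm (z + h * of_real s) \<le> norm z + norm h * \<bar>s\<bar>"
      by (rule order_trans[OF norm_triangle_ineq]) (simp add: norm_mult)
    also have "norm h * \<bar>s\<bar> \<le> (norm h + 1) * \<delta>"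
      using s by (intro mult_mono) auto
    also have "(norm h + 1) * \<delta> = (1 - norm z) / 2"
      using norm_ge_zero[of h] by (simp add: \<delta>_def field_simps add_nonneg_eq_0_iff)
    finally show ?thesis by (simp add: \<rho>_def field_simps)
  qed
  obtain C where C: "\<And>u. norm u \<le> \<rho> \<Longrightarrow> norm (K_dz \<alpha> \<beta> u) \<le> C"
    using bounded_image_cball[OF continuous_on_K_dz \<rho>] by blast
  obtain D where D: "\<And>u. norm u \<le> \<rho> \<Longrightarrow> norm (K_dcnj \<alpha> \<beta> u) \<le> D"
    using bounded_image_cball[OF continuous_on_K_dcnj \<rho>] by blast
  define g' where "g' s t = (K_dz \<alpha> \<beta> ((z + h * of_real s) * cis (- t)) * (h * cis (- t))
      + K_dcnj \<alpha> \<beta> ((z + h * of_real s) * cis (- t)) * cnj (h * cis (- t))) * f (cis t)" for s t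
  have "((\<lambda>s. LINT t|arc. K_kernel \<alpha> \<beta> ((z + h * of_real s) * cis (- t)) * f (cis t))
      has_vector_derivative (LINT t|arc. g' 0 t)) (at 0)"
  proof (rule has_vector_derivative_LINT[OF \<delta>])
    fix s :: real assume s: "\<bar>s\<bar> < \<delta>"
    then show "integrable arc (\<lambda>t. K_kernel \<alpha> \<beta> ((z + h * of_real s) * cis (- t)) * f (cis t))"
      using inside \<rho>
      by (intro integrable_arc_continuous_mult f continuous_on_rotate continuous_on_K_kernel) force
    fix t
    have u: "norm ((z + h * of_real s) * cis (- t)) \<le> \<rho>"
      using inside[OF s] by (simp add: norm_mult)
    have "((\<lambda>s. (z + h * of_real s) * cis (- t)) has_vector_derivative h * cis (- t)) (at s)"
    proof -
      have "((\<lambda>x. (z + h * x) * cis (- t)) has_field_derivative h * cis (- t)) (at (of_real s))"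
        by (auto intro!: derivative_eq_intros)
      then show ?thesis
        by (rule has_vector_derivative_real_field)
    qed
    from has_vector_derivative_K_kernel[OF this] u \<rho>
    show "((\<lambda>s. K_kernel \<alpha> \<beta> ((z + h * of_real s) * cis (- t)) * f (cis t))
        has_vector_derivative g' s t) (at s)"
      unfolding g'_def by (intro has_vector_derivative_mult_left) auto
    have "norm (K_dz \<alpha> \<beta> ((z + h * of_real s) * cis (- t)) * (h * cis (- t))
      + K_dcnj \<alpha> \<beta> ((z + h * of_real s) * cis (- t)) * cnj (h * cis (- t))) \<le> C * norm h + D * norm h"
      using C[OF u] D[OF u]
      by (intro order_trans[OF norm_triangle_ineq] add_mono) (auto simp: norm_mult intro: mult_right_mono)
    then show "norm (g' s t) \<le> (C * norm h + D * norm h) * norm (f (cis t))"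
      unfolding g'_def norm_mult[of _ "f (cis t)"] by (rule mult_right_mono) simp
  next
    show "integrable arc (\<lambda>t. (C * norm h + D * norm h) * norm (f (cis t)))"
      using f by simp
  qed
  from has_vector_derivative_mult_right[OF this, of "1 / (2 * of_real pi)"]
  have "((\<lambda>s. K_integral \<alpha> \<beta> f (z + h * of_real s)) has_vector_derivative
      1 / (2 * of_real pi) * (LINT t|arc. g' 0 t)) (at 0)"
    by (simp add: K_integral_def)
  moreover have "g' 0 t = h * (K_dz \<alpha> \<beta> (z * cis (- t)) * cis (- t) * f (cis t))
      + cnj h * (K_dcnj \<alpha> \<beta> (z * cis (- t)) * cis t * f (cis t))" for t
    by (simp add: g'_def cis_cnj algebra_simps)
  then have "(LINT t|arc. g' 0 t) = h * (LINT t|arc. K_dz \<alpha> \<beta> (z * cis (- t)) * cis (- t) * f (cis t))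
      + cnj h * (LINT t|arc. K_dcnj \<alpha> \<beta> (z * cis (- t)) * cis t * f (cis t))"
    using integrable_rotate_mult[OF continuous_on_K_dz[of \<alpha> \<beta>], of "-1"]
      integrable_rotate_mult[OF continuous_on_K_dcnj[of \<alpha> \<beta>], of 1]
    by simp
  ultimately show ?thesis
    by (simp add: algebra_simps add_divide_distrib)
qed

lemma wirtinger_K_integral:
  shows "wirtinger_z (K_integral \<alpha> \<beta> f) z
      = 1 / (2 * of_real pi) * (LINT t|arc. K_dz \<alpha> \<beta> (z * cis (- t)) * cis (- t) * f (cis t))" (is "_ = ?P")
    and "wirtinger_cnj (K_integral \<alpha> \<beta> f) z
      = 1 / (2 * of_real pi) * (LINT t|arc. K_dcnj \<alpha> \<beta> (z * cis (- t)) * cis t * f (cis t))" (is "_ = ?Q")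
proof -
  define P Q where "P = ?P" and "Q = ?Q"
  \<comment> \<open>In the directions 1 and \<open>\<i>\<close> the derivative is
    \<open>P + Q\<close> and \<open>\<i> * P - \<i> * Q\<close>; the Wirtinger combinations isolate
    \<open>P\<close> and \<open>Q\<close>.\<close>
  note deriv = vector_derivative_at[OF has_vector_derivative_K_integral, of \<alpha> \<beta>, folded P_def Q_def]
  have parts: "partial_x (K_integral \<alpha> \<beta> f) z = P + Q" "partial_y (K_integral \<alpha> \<beta> f) z = \<i> * P - \<i> * Q"
    unfolding partial_x_def partial_y_def using deriv[of 1] deriv[of \<i>] by simp_all
  show "wirtinger_z (K_integral \<alpha> \<beta> f) z = ?P" "wirtinger_cnj (K_integral \<alpha> \<beta> f) z = ?Q"
    unfolding wirtinger_z_def wirtinger_cnj_def parts P_def[symmetric] Q_def[symmetric]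
    by (simp_all add: algebra_simps)
qed

lemma integrable_Poisson:
  "integrable arc (\<lambda>t. norm (1 - z * cis (- t)) powr (- s) * norm (f (cis t)))"
proof -
  have "integrable arc (\<lambda>t. of_real (norm (1 - z * cis (- t)) powr (- s)) * f (cis t))"
    using one_minus_rotate_nonzero[OF z]
    by (intro integrable_arc_continuous_mult f continuous_intros) auto
  from integrable_norm[OF this] show ?thesis
    by (simp add: norm_mult)
qed

text \<open>Serves both derivatives, with \<open>c\<close> equal to -1 or 1: the factor
  \<open>cis (c * t)\<close> has modulus 1, and \<open>z * cis (- t)\<close> never leaves the circle
  of radius \<open>norm z\<close>.\<close>

lemma norm_LINT_rotate_le_Poisson_mean:
  assumes F: "continuous_on (ball 0 1) F"
    and le: "\<And>u. norm u = norm z \<Longrightarrow> norm (F u) \<le> B * norm (1 - u) powr (- s)"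
  shows "norm (1 / (2 * of_real pi) * (LINT t|arc. F (z * cis (- t)) * cis (c * t) * f (cis t)))
    \<le> B * Poisson_mean f z s"
proof -
  have "norm (LINT t|arc. F (z * cis (- t)) * cis (c * t) * f (cis t))
      \<le> (LINT t|arc. norm (F (z * cis (- t)) * cis (c * t) * f (cis t)))"
    by (rule integral_norm_bound)
  also have "\<dots> \<le> (LINT t|arc. B * (norm (1 - z * cis (- t)) powr (- s) * norm (f (cis t))))"
    using le[of "z * cis (- t)" for t]
    by (intro integral_mono integrable_norm integrable_rotate_mult F integrable_mult_right integrable_Poisson)
       (auto simp: norm_mult mult.assoc[symmetric] intro: mult_right_mono)
  finally show ?thesis
    by (simp add: Poisson_mean_def norm_divide norm_mult divide_right_mono)
qed

lemma norm_wirtinger_K_integral_le: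
  fixes \<alpha> \<beta> :: complex
  defines "B \<equiv> norm (c_coeff \<alpha> \<beta>) * exp (pi / 2 * \<bar>Im (\<alpha> - \<beta>)\<bar>) * (1 - (norm z)\<^sup>2) powr Re (\<alpha> + \<beta>)"
  shows "norm (wirtinger_z (K_integral \<alpha> \<beta> f) z)
      \<le> (norm (\<alpha> + 1) + norm \<beta> * norm z) * (B * Poisson_mean f z (Re (\<alpha> + \<beta>) + 2))"
    and "norm (wirtinger_cnj (K_integral \<alpha> \<beta> f) z)
      \<le> (norm (\<beta> + 1) + norm \<alpha> * norm z) * (B * Poisson_mean f z (Re (\<alpha> + \<beta>) + 2))"
proof -
  \<comment> \<open>Quantified over \<alpha> and \<beta> so that the bound for \<open>K_dcnj\<close>
    is the instance with the two exchanged, at \<open>cnj u\<close>.\<close>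
  have dz: "norm (K_dz \<alpha> \<beta> u) \<le> (norm (\<alpha> + 1) + norm \<beta> * norm z)
      * (norm (c_coeff \<alpha> \<beta>) * exp (pi / 2 * \<bar>Im (\<alpha> - \<beta>)\<bar>) * (1 - (norm z)\<^sup>2) powr Re (\<alpha> + \<beta>))
      * norm (1 - u) powr (- (Re (\<alpha> + \<beta>) + 2))"
    if u: "norm u = norm z" for u \<alpha> \<beta>
  proof -
    define R where "R = 1 - (norm z)\<^sup>2"
    define C where "C = norm (c_coeff \<alpha> \<beta>) * exp (pi / 2 * \<bar>Im (\<alpha> - \<beta>)\<bar>)"
    define W where "W = norm (1 - u) powr (- (Re (\<alpha> + \<beta>) + 2))"
    define A where "A = norm (\<alpha> + 1) + norm \<beta> * norm z"
    have R: "R > 0"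
      using one_minus_square_norm_pos[OF z] by (simp add: R_def)
    have "norm (K_kernel \<alpha> \<beta> u) \<le> C * R powr (Re (\<alpha> + \<beta>) + 1) * W"
      using norm_K_kernel_le[of u \<alpha> \<beta>] u z by (simp add: C_def R_def W_def)
    then have "norm (K_kernel \<alpha> \<beta> u) / R * A \<le> C * R powr (Re (\<alpha> + \<beta>) + 1) * W / R * A"
      using R by (intro mult_right_mono divide_right_mono) (auto simp: A_def)
    moreover have "norm (K_dz \<alpha> \<beta> u) \<le> norm (K_kernel \<alpha> \<beta> u) / R * A"
      using norm_K_dz_le[of u \<alpha> \<beta>] u z by (simp add: R_def A_def)
    moreover have "R powr (Re (\<alpha> + \<beta>) + 1) = R powr Re (\<alpha> + \<beta>) * R"
      using R by (simp add: powr_add)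
    ultimately have "norm (K_dz \<alpha> \<beta> u) \<le> A * (C * R powr Re (\<alpha> + \<beta>)) * W"
      using R by (simp add: mult_ac)
    then show ?thesis
      by (simp only: A_def C_def R_def W_def)
  qed
  have dcnj: "norm (K_dcnj \<alpha> \<beta> u) \<le> (norm (\<beta> + 1) + norm \<alpha> * norm z) * B
      * norm (1 - u) powr (- (Re (\<alpha> + \<beta>) + 2))" if "norm u = norm z" for u
  proof -
    have "c_coeff \<beta> \<alpha> = c_coeff \<alpha> \<beta>"
      by (simp add: c_coeff_def mult.commute add.commute)
    moreover have "norm (1 - cnj u) = norm (1 - u)"
      by (metis complex_cnj_diff complex_cnj_one complex_mod_cnj)
    moreover have "\<bar>Im (\<beta> - \<alpha>)\<bar> = \<bar>Im (\<alpha> - \<beta>)\<bar>"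
      by simp
    ultimately show ?thesis
      using dz[of "cnj u" \<beta> \<alpha>] that by (simp only: K_dcnj_eq B_def add.commute[of \<beta> \<alpha>] complex_mod_cnj)
  qed
  show "norm (wirtinger_z (K_integral \<alpha> \<beta> f) z)
      \<le> (norm (\<alpha> + 1) + norm \<beta> * norm z) * (B * Poisson_mean f z (Re (\<alpha> + \<beta>) + 2))"
    using norm_LINT_rotate_le_Poisson_mean[OF continuous_on_K_dz dz, of \<alpha> \<beta> "-1"]
    by (simp add: wirtinger_K_integral B_def mult.assoc)
  show "norm (wirtinger_cnj (K_integral \<alpha> \<beta> f) z)
      \<le> (norm (\<beta> + 1) + norm \<alpha> * norm z) * (B * Poisson_mean f z (Re (\<alpha> + \<beta>) + 2))"
    using norm_LINT_rotate_le_Poisson_mean[OF continuous_on_K_dcnj dcnj, of 1]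
    by (simp add: wirtinger_K_integral mult.assoc)
qed

text \<open>The distance from 1 to the circle of radius \<open>norm z\<close> is
  \<open>1 - norm z\<close>, and the exponent \<open>- s\<close> is nonpositive.\<close>

lemma Poisson_mean_le_L1:
  assumes "s \<ge> 0"
  shows "Poisson_mean f z s \<le> (1 - norm z) powr (- s) * circle_norm 1 f"
proof -
  have "norm (1 - z * cis (- t)) powr (- s) \<le> (1 - norm z) powr (- s)" for t
  proof (rule powr_mono2')
    show "1 - norm z \<le> norm (1 - z * cis (- t))"
      using norm_triangle_ineq2[of 1 "z * cis (- t)"] by (simp add: norm_mult)
  qed (use assms z in auto)
  then have "(LINT t|arc. norm (1 - z * cis (- t)) powr (- s) * norm (f (cis t)))
      \<le> (LINT t|arc. (1 - norm z) powr (- s) * norm (f (cis t)))"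
    using f by (intro integral_mono integrable_Poisson) (auto intro: mult_right_mono)
  then show ?thesis
    by (simp add: Poisson_mean_def circle_norm_def divide_right_mono abs_of_nonneg integral_nonneg_AE)
qed

end

subsection \<open>Estimates in terms of the \<open>L\<^sup>p\<close> norm\<close>

lemma ennreal_conjugate_exponents:
  fixes p q :: ennreal
  assumes p: "1 < p" "p < \<infinity>" and pq: "1 / p + 1 / q = 1"
  shows "enn2real p > 1" "enn2real q > 1" "1 / enn2real p + 1 / enn2real q = 1"
    and "enn2real (1 / p) = 1 / enn2real p"
proof -
  obtain a where a: "p = ennreal a" "a > 1"
    using p by (cases p) (auto simp: ennreal_less_iff simp flip: ennreal_1)
  have inv_a: "1 / p = ennreal (1 / a)"
    using a by (simp add: divide_ennreal flip: ennreal_1)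
  \<comment> \<open>For \<open>q = 0\<close> the sum of reciprocals would be infinite; for
    \<open>q = top\<close> it would be \<open>1 / p\<close>, which is less than 1.\<close>
  have "q \<noteq> 0"
    using pq by (auto simp: ennreal_divide_self)
  moreover have "q \<noteq> top"
    using pq a inv_a by (auto simp: ennreal_eq_1)
  ultimately obtain b where b: "q = ennreal b" "b > 0"
    by (cases q) (auto simp: less_le)
  have "1 / q = ennreal (1 / b)"
    using b by (simp add: divide_ennreal flip: ennreal_1)
  then have ab: "1 / a + 1 / b = 1"
    using pq a b inv_a by (simp add: ennreal_eq_1 flip: ennreal_plus)
  moreover have "b > 1"
  proof -
    have "1 / b < 1" using ab a by (smt (verit) zero_less_divide_1_iff)
    with b show ?thesis by simp
  qed
  ultimately show "enn2real p > 1" "enn2real q > 1" "1 / enn2real p + 1 / enn2real q = 1"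
    "enn2real (1 / p) = 1 / enn2real p"
    using a b inv_a by simp_all
qed

lemma ennreal_conjugate_infinity:
  fixes q :: ennreal
  assumes "1 / \<infinity> + 1 / q = 1"
  shows "q = 1"
proof -
  have q: "1 / q = 1"
    using assms by simp
  then have "q \<noteq> 0" "q \<noteq> top"
    by auto
  then obtain b where b: "q = ennreal b" "b > 0"
    by (cases q) (auto simp: less_le)
  then show ?thesis
    using q by (simp add: divide_ennreal ennreal_eq_1 flip: ennreal_1)
qed

lemma AE_norm_le_circle_norm_infinity:
  assumes "f \<in> circle_Lp \<infinity>"
  shows "AE t in arc. norm (f (cis t)) \<le> circle_norm \<infinity> f"
  using esssup_AE[of "\<lambda>t. ennreal (norm (f (cis t)))" arc]
proof eventually_elim
  case (elim t)
  \<comment> \<open>Finiteness of the essential supremum is essential here, since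
    \<open>enn2real\<close> sends \<open>top\<close> to 0.\<close>
  then have "enn2real (ennreal (norm (f (cis t)))) \<le> enn2real (esssup arc (\<lambda>t. ennreal (norm (f (cis t)))))"
    using assms by (intro enn2real_mono) (auto simp: circle_Lp_def)
  then show ?case
    by (simp add: circle_norm_def)
qed

text \<open>The arc has finite measure. For finite \<open>p\<close> the modulus is at most 1 plus
  its power, and for infinite \<open>p\<close> it is bounded almost everywhere; differentiation
  under the integral is thus available for every \<open>p\<close>.\<close>

lemma circle_Lp_imp_integrable:
  assumes p: "1 \<le> p" and f: "f \<in> circle_Lp p"
  shows "integrable arc (\<lambda>t. f (cis t))"
proof -
  interpret finite_measure arc
    by (rule finite_measure_lebesgue_on) auto
  have meas: "(\<lambda>t. f (cis t)) \<in> borel_measurable arc"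
    using f by (simp add: circle_Lp_def)
  show ?thesis
  proof (cases "p = \<infinity>")
    case True
    then show ?thesis
      using f meas by (intro integrable_const_bound[OF AE_norm_le_circle_norm_infinity]) auto
  next
    case False
    then obtain a where a: "p = ennreal a" "a \<ge> 1"
      using p by (cases p) (auto simp flip: ennreal_1)
    have "norm x \<le> 1 + norm x powr a" for x :: complex
    proof (cases "norm x \<le> 1")
      case True
      then show ?thesis using powr_ge_zero[of "norm x" a] by linarith
    next
      case False
      then have "norm x powr 1 \<le> norm x powr a"
        using a by (intro powr_mono) auto
      then show ?thesis by simp
    qed
    moreover have "integrable arc (\<lambda>t. 1 + norm (f (cis t)) powr a)"
      using f False a by (auto simp: circle_Lp_def)
    ultimately show ?thesis
      using meas by (elim Bochner_Integration.integrable_bound) (auto intro: order_trans[OF _ abs_ge_self])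
  qed
qed

lemma Poisson_mean_le_Lp:
  assumes p: "1 < p" "1 / p + 1 / q = 1" and f: "f \<in> circle_Lp p" and z: "norm z < 1"
  shows "Poisson_mean f z s \<le> circle_norm p f
    * (1 / (2 * pi) * (LINT t|arc. norm (1 - z * cis (- t)) powr (- (s * enn2real q)))) powr (1 / enn2real q)"
proof -
  define W where "W t = norm (1 - z * cis (- t)) powr (- s)" for t
  have W_cont: "continuous_on {0..2 * pi} (\<lambda>t. norm (1 - z * cis (- t)) powr a)" for a
    using one_minus_rotate_nonzero[OF z] by (intro continuous_intros) auto
  have fi: "integrable arc (\<lambda>t. f (cis t))"
    using p f by (intro circle_Lp_imp_integrable) auto
  show ?thesis
  proof (cases "p = \<infinity>")
    case True
    then have q: "q = 1"
      using p ennreal_conjugate_infinity by blast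
    have int: "integrable arc W"
      unfolding W_def by (rule integrable_continuous_lebesgue_on[OF W_cont])
    have "AE t in arc. norm (f (cis t)) \<le> circle_norm p f"
      using AE_norm_le_circle_norm_infinity[of f] f True by simp
    then have "AE t in arc. W t * norm (f (cis t)) \<le> W t * circle_norm p f"
      by eventually_elim (simp add: W_def mult_left_mono)
    moreover have "integrable arc (\<lambda>t. W t * norm (f (cis t)))"
      unfolding W_def by (rule integrable_Poisson[OF fi z])
    ultimately have "(LINT t|arc. W t * norm (f (cis t))) \<le> (LINT t|arc. W t * circle_norm p f)"
      using int by (intro integral_mono_AE) auto
    also have "\<dots> = circle_norm p f * (LINT t|arc. W t)"
      by simp
    finally show ?thesis
      using int by (simp add: Poisson_mean_def q W_def divide_right_mono integral_nonneg_AE)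
  next
    case False
    define a b where "a = enn2real p" and "b = enn2real q"
    have ab: "a > 1" "b > 1" "1 / a + 1 / b = 1"
      using ennreal_conjugate_exponents[of p q] p False by (auto simp: a_def b_def top.not_eq_extremum)
    have W_powr: "W t powr b = norm (1 - z * cis (- t)) powr (- (s * b))" for t
      by (simp add: W_def powr_powr)
    define N where "N = (LINT t|arc. norm (f (cis t)) powr a)"
    define V where "V = (LINT t|arc. W t powr b)"
    have nonneg: "N \<ge> 0" "V \<ge> 0"
      by (simp_all add: N_def V_def integral_nonneg_AE)
    have "(LINT t|arc. norm (f (cis t)) * W t) \<le> N powr (1 / a) * V powr (1 / b)"
      unfolding N_def V_def
    proof (rule Holder_inequality_nonneg(2)[OF ab])
      show "(\<lambda>t. norm (f (cis t))) \<in> borel_measurable arc" "W \<in> borel_measurable arc"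
        using fi integrable_continuous_lebesgue_on[OF W_cont] by (auto simp: W_def[abs_def])
      show "integrable arc (\<lambda>t. norm (f (cis t)) powr a)"
        using f False by (simp add: circle_Lp_def a_def)
      show "integrable arc (\<lambda>t. W t powr b)"
        unfolding W_powr by (rule integrable_continuous_lebesgue_on[OF W_cont])
    qed (auto simp: W_def)
    then have "Poisson_mean f z s \<le> 1 / (2 * pi) * (N powr (1 / a) * V powr (1 / b))"
      by (simp add: Poisson_mean_def W_def mult.commute divide_right_mono)
    \<comment> \<open>The normalising factor is distributed over the two integrals according to
      \<open>1 / a + 1 / b = 1\<close>, so that both become means.\<close>
    also have "1 / (2 * pi) = (1 / (2 * pi)) powr (1 / a) * (1 / (2 * pi)) powr (1 / b)"
      using ab by (simp flip: powr_add)
    also have "\<dots> * (N powr (1 / a) * V powr (1 / b))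
        = (1 / (2 * pi) * N) powr (1 / a) * (1 / (2 * pi) * V) powr (1 / b)"
      using nonneg by (simp only: powr_mult mult_ac)
    finally show ?thesis
      using False by (simp add: circle_norm_def N_def V_def W_powr flip: a_def b_def)
  qed
qed

section \<open>Combination of the derivative and mean estimates\<close>

theorem theorem5:
  fixes \<alpha> \<beta> z :: complex and p q :: ennreal and r \<theta> :: real
    and f w :: "complex \<Rightarrow> complex"
  assumes "\<alpha> \<notin> of_int ` {n. n < 0}" and "\<beta> \<notin> of_int ` {n. n < 0}"
    and "Re (\<alpha> + \<beta>) > -1"
    and "1 \<le> p" and "1 / p + 1 / q = 1"
    and "f \<in> circle_Lp p"
    and "w = K_integral \<alpha> \<beta> f"
    and "z = of_real r * cis \<theta>" and "0 \<le> r" and "r < 1"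
  defines "lhs \<equiv> norm (wirtinger_z w z) / (norm (\<alpha> + 1) + norm \<beta> * norm z)
               + norm (wirtinger_cnj w z) / (norm (\<beta> + 1) + norm \<alpha> * norm z)"
    and "F2 \<equiv> (gauss_F (1 - (Re (\<alpha> + \<beta>) + 2) * enn2real q / 2)
                       (1 - (Re (\<alpha> + \<beta>) + 2) * enn2real q / 2) 1 (r\<^sup>2)) powr (1 / enn2real q)"
  shows "(p = 1 \<longrightarrow>
            lhs \<le> 2 * norm (c_coeff \<alpha> \<beta>) * exp (pi / 2 * \<bar>Im (\<alpha> - \<beta>)\<bar>)
                  * ((1 - (norm z)\<^sup>2) powr Re (\<alpha> + \<beta>) / (1 - norm z) powr (Re (\<alpha> + \<beta>) + 2))
                  * circle_norm 1 f) \<and>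
         (1 < p \<longrightarrow>
            lhs \<le> 2 * norm (c_coeff \<alpha> \<beta>) * circle_norm p f
                  / (1 - (norm z)\<^sup>2) powr (1 + enn2real (1 / p))
                  * exp (pi / 2 * \<bar>Im (\<alpha> - \<beta>)\<bar>) * F2)"
proof -
  define s where "s = Re (\<alpha> + \<beta>) + 2"
  define C where "C = norm (c_coeff \<alpha> \<beta>) * exp (pi / 2 * \<bar>Im (\<alpha> - \<beta>)\<bar>)"
  define R where "R = 1 - (norm z)\<^sup>2"
  have norm_z: "norm z = r"
    using assms by (simp add: norm_mult)
  then have z: "norm z < 1" using assms by simp
  have R: "R > 0"
    using one_minus_square_norm_pos[OF z] by (simp add: R_def)
  have C: "C \<ge> 0" by (simp add: C_def)
  have fi: "integrable arc (\<lambda>t. f (cis t))"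
    using assms by (intro circle_Lp_imp_integrable)
  \<comment> \<open>Excluding negative integers rules out -1 in particular, so both denominators are
    positive.\<close>
  have pos: "norm (\<gamma> + 1) + norm \<delta> * norm z > 0" if "\<gamma> \<notin> of_int ` {n. n < 0}" for \<gamma> \<delta> :: complex
  proof -
    have "- 1 \<in> complex_of_int ` {n. n < 0}"
      by (rule image_eqI[of _ _ "- 1"]) auto
    with that have "\<gamma> + 1 \<noteq> 0"
      by (metis add_eq_0_iff2)
    then show ?thesis
      by (simp add: add_pos_nonneg)
  qed
  \<comment> \<open>One bound serves both quotients, hence the factor 2.\<close>
  define A where "A = C * R powr (s - 2) * Poisson_mean f z s"
  have "norm (wirtinger_z w z) \<le> (norm (\<alpha> + 1) + norm \<beta> * norm z) * A"
    "norm (wirtinger_cnj w z) \<le> (norm (\<beta> + 1) + norm \<alpha> * norm z) * A"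
    using norm_wirtinger_K_integral_le[OF fi z, of \<alpha> \<beta>] assms(7)
    by (simp_all add: A_def C_def R_def s_def)
  then have "norm (wirtinger_z w z) / (norm (\<alpha> + 1) + norm \<beta> * norm z) \<le> A"
    "norm (wirtinger_cnj w z) / (norm (\<beta> + 1) + norm \<alpha> * norm z) \<le> A"
    using pos[OF assms(1)] pos[OF assms(2)] by (simp_all add: pos_divide_le_eq mult.commute)
  then have lhs: "lhs \<le> 2 * C * R powr (s - 2) * Poisson_mean f z s"
    unfolding lhs_def A_def by simp
  show ?thesis
  proof (intro conjI impI)
    assume "p = 1"
    have "Poisson_mean f z s \<le> (1 - norm z) powr (- s) * circle_norm 1 f"
      using assms(3) by (intro Poisson_mean_le_L1[OF fi z]) (simp add: s_def)
    then have "2 * C * R powr (s - 2) * Poisson_mean f z s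
        \<le> 2 * C * R powr (s - 2) * ((1 - norm z) powr (- s) * circle_norm 1 f)"
      using C by (intro mult_left_mono) auto
    also have "\<dots> = 2 * C * (R powr (s - 2) / (1 - norm z) powr s) * circle_norm 1 f"
      by (simp add: powr_minus divide_inverse)
    finally show "lhs \<le> 2 * norm (c_coeff \<alpha> \<beta>) * exp (pi / 2 * \<bar>Im (\<alpha> - \<beta>)\<bar>)
        * ((1 - (norm z)\<^sup>2) powr Re (\<alpha> + \<beta>) / (1 - norm z) powr (Re (\<alpha> + \<beta>) + 2))
        * circle_norm 1 f"
      using lhs by (simp add: C_def R_def s_def)
  next
    assume p: "1 < p"
    define b where "b = enn2real q"
    \<comment> \<open>For infinite \<open>p\<close> this holds with \<open>b = 1\<close>, where both
      sides of the equation are 0.\<close>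
    have b: "b > 0" "enn2real (1 / p) = 1 - 1 / b"
      using ennreal_conjugate_exponents[of p q] ennreal_conjugate_infinity[of q] p assms(5)
      by (cases "p = \<infinity>"; force simp: b_def top.not_eq_extremum)+
    define F where "F = gauss_F (1 - s * b / 2) (1 - s * b / 2) 1 (r\<^sup>2)"
    define m where "m = 1 / (2 * pi) * (LINT t|arc. norm (1 - z * cis (- t)) powr (- (s * b)))"
    have m: "m = R powr (1 - s * b) * F"
      unfolding m_def F_def R_def by (simp only: mean_powr_eq_gauss_F[OF z] norm_z)
    have "m \<ge> 0"
      by (simp add: m_def integral_nonneg_AE)
    \<comment> \<open>The sign of the hypergeometric value is inferred from that of the mean;
      splitting the power of the product in \<open>m\<close> relies on it.\<close>
    then have F: "F \<ge> 0"
      using R by (simp add: m zero_le_mult_iff)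
    have "m powr (1 / b) = R powr ((1 - s * b) / b) * F powr (1 / b)"
      using F by (simp add: m powr_mult powr_powr)
    moreover have "(1 - s * b) / b = 1 / b - s"
      using b by (simp add: field_simps)
    \<comment> \<open>The exponents add up to \<open>1 / b - 2\<close>, which is the negative of
      \<open>1 + enn2real (1 / p)\<close>.\<close>
    moreover have "R powr (s - 2) * R powr (1 / b - s) = inverse (R powr (1 + enn2real (1 / p)))"
      unfolding powr_add[symmetric] powr_minus[symmetric] b by (simp add: algebra_simps)
    ultimately have "R powr (s - 2) * m powr (1 / b) = F powr (1 / b) / R powr (1 + enn2real (1 / p))"
      by (simp add: divide_inverse mult_ac flip: mult.assoc)
    moreover have "Poisson_mean f z s \<le> circle_norm p f * m powr (1 / b)"
      unfolding m_def b_def by (rule Poisson_mean_le_Lp[OF p assms(5,6) z])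
    then have "2 * C * R powr (s - 2) * Poisson_mean f z s
        \<le> 2 * C * R powr (s - 2) * (circle_norm p f * m powr (1 / b))"
      using C by (intro mult_left_mono) auto
    ultimately have "lhs \<le> 2 * C * circle_norm p f * (F powr (1 / b) / R powr (1 + enn2real (1 / p)))"
      using lhs by (simp add: mult_ac)
    then show "lhs \<le> 2 * norm (c_coeff \<alpha> \<beta>) * circle_norm p f
        / (1 - (norm z)\<^sup>2) powr (1 + enn2real (1 / p)) * exp (pi / 2 * \<bar>Im (\<alpha> - \<beta>)\<bar>) * F2"
      by (simp add: F2_def F_def R_def C_def s_def b_def mult_ac)
  qed
qed

end
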